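(* Let $0<\beta<1$, let $a$ be a real number, and let $\rho\in C(0,+\infty)\cap L^{1}_{Loc}[0,+\infty)$. If $\lim_{t\to+\infty}t^{\beta}\rho(t)=a$, then $$\lim_{t\to+\infty}\int_{0}^{t}(t-s)^{\beta-1}\rho(s)\,ds=\frac{a\pi}{\sin(\beta\pi)}.$$
   Context: $C(0,+\infty)$ is the set of continuous real-valued functions on $(0,+\infty)$. $L^{1}_{Loc}[0,+\infty)$ is the space of all real-valued functions $f$ such that $|f|$ is Lebesgue integrable over every bounded subinterval of $[0,+\infty)$ (in particular near $0$). *)

theory Defs
  imports "HOL-Analysis.Analysis"
begin

definition L1_Loc :: "(real \<Rightarrow> real) set" where
  "L1_Loc = {f. \<forall>I. is_interval I \<longrightarrow> bounded I \<longrightarrow> I \<subseteq> {0..} \<longrightarrow> set_integrable lebesgue I f}"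

end

theory Submission
  imports Defs "HOL-Real_Asymp.Real_Asymp"
begin

text \<open>
  The Abel kernel \<open>(t - s) powr (\<beta> - 1)\<close> is homogeneous of degree \<open>\<beta> - 1\<close>, and \<open>\<rho> s\<close> is asymptotic
  to \<open>a * s powr - \<beta>\<close>, so the substitution \<open>s = t * u\<close> removes all powers of \<open>t\<close>: the integral
  becomes that of \<open>u powr - \<beta> * (1 - u) powr (\<beta> - 1)\<close> over the unit interval, weighted by
  \<open>\<phi> (t * u)\<close> with \<open>\<phi> s = s powr \<beta> * \<rho> s\<close>. As \<open>t\<close> grows the weight tends to \<open>a\<close> for each fixed
  \<open>u > 0\<close>, which leaves \<open>a\<close> times the Beta integral \<open>Beta (1 - \<beta>) \<beta>\<close>, and this is
  \<open>pi / sin (\<beta> * pi)\<close> by the reflection formula for the Gamma function.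

  Dominated convergence justifies the passage to the limit only where \<open>\<phi>\<close> is bounded, that is, beyond
  some threshold \<open>T\<close>: near \<open>0\<close> the function \<open>\<rho>\<close> is merely integrable. The integral is therefore
  split at \<open>T\<close>. On \<open>{0<..T}\<close> the kernel tends to \<open>0\<close> uniformly while \<open>\<rho>\<close> stays fixed, so this part
  vanishes in the limit (\<open>head_tendsto_0\<close>); the scaling argument applies to the rest
  (\<open>tail_tendsto\<close>).
\<close>

section \<open>The limiting Beta integral\<close>

lemma Beta_reflection_real:
  fixes b :: real
  shows "Beta (1 - b) b = pi / sin (b * pi)"
proof -
  have "complex_of_real (Gamma b * Gamma (1 - b)) = Gamma (of_real b) * Gamma (1 - of_real b)"
    using Gamma_complex_of_real[of b] Gamma_complex_of_real[of "1 - b"] by simp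
  also have "\<dots> = complex_of_real (pi / sin (pi * b))"
    using sin_of_real[of "pi * b", where 'a = complex] by (simp add: Gamma_reflection_complex)
  finally have "Gamma b * Gamma (1 - b) = pi / sin (pi * b)"
    by (simp only: of_real_eq_iff)
  then show ?thesis
    by (simp add: Beta_def mult.commute)
qed

lemma Beta_kernel_lborel:
  fixes b :: real
  assumes "0 < b" "b < 1"
  defines "k \<equiv> \<lambda>u. indicator {0..1} u * (u powr - b * (1 - u) powr (b - 1))"
  shows "integrable lborel k" and "integral\<^sup>L lborel k = pi / sin (b * pi)"
proof -
  have int: "set_integrable lborel {0..1} (\<lambda>u. u powr - b * (1 - u) powr (b - 1))"
    using integrable_Beta[of "1 - b" b] assms(1,2) by simp
  then show "integrable lborel k"
    by (simp add: set_integrable_def k_def)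
  have "integral\<^sup>L lborel k = (LINT u:{0..1}|lborel. u powr - b * (1 - u) powr (b - 1))"
    by (simp add: set_lebesgue_integral_def k_def)
  also have "\<dots> = integral {0..1} (\<lambda>u. u powr - b * (1 - u) powr (b - 1))"
    using int by (rule set_borel_integral_eq_integral)
  also have "\<dots> = Beta (1 - b) b"
    using has_integral_Beta_real[of "1 - b" b] assms(1,2) by (intro integral_unique) simp
  finally show "integral\<^sup>L lborel k = pi / sin (b * pi)"
    by (simp add: Beta_reflection_real)
qed

section \<open>The contribution near the origin\<close>

text \<open>Once \<open>t \<ge> T + 1\<close> the kernel is at most \<open>1\<close> on \<open>{0<..T}\<close>, so \<open>\<rho>\<close> itself dominates the
  integrand.\<close>

lemma head_integrand_le:
  fixes b t T s r :: real
  assumes "b < 1" "T + 1 \<le> t" "s \<le> T"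
  shows "\<bar>(t - s) powr (b - 1) * r\<bar> \<le> \<bar>r\<bar>"
proof -
  have "(t - s) powr (b - 1) \<le> 1"
    using assms powr_mono2'[of "b - 1" 1 "t - s"] by simp
  then show ?thesis
    by (simp add: abs_mult mult_left_le_one_le)
qed

lemma head_integrable:
  fixes b t T :: real and \<rho> :: "real \<Rightarrow> real"
  assumes "b < 1" "T + 1 \<le> t" and \<rho>: "set_integrable lebesgue {0<..T} \<rho>"
  shows "set_integrable lebesgue {0<..T} (\<lambda>s. (t - s) powr (b - 1) * \<rho> s)"
  unfolding set_integrable_def
proof (rule Bochner_Integration.integrable_bound[OF \<rho>[unfolded set_integrable_def]])
  have [measurable]: "(\<lambda>s. indicator {0<..T} s * \<rho> s) \<in> borel_measurable lebesgue"
    using \<rho> by (simp add: set_integrable_def borel_measurable_integrable)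
  have [measurable]: "(\<lambda>s. (t - s) powr (b - 1)) \<in> borel_measurable lebesgue"
    by (intro measurable_completion) measurable
  have "(\<lambda>s. (t - s) powr (b - 1) * (indicator {0<..T} s * \<rho> s)) \<in> borel_measurable lebesgue"
    by measurable
  then show "(\<lambda>s. indicat_real {0<..T} s *\<^sub>R ((t - s) powr (b - 1) * \<rho> s)) \<in> borel_measurable lebesgue"
    by (simp add: mult_ac)
  show "AE s in lebesgue. norm (indicat_real {0<..T} s *\<^sub>R ((t - s) powr (b - 1) * \<rho> s))
          \<le> norm (indicat_real {0<..T} s *\<^sub>R \<rho> s)"
    using head_integrand_le[OF assms(1,2)] by (intro AE_I2) (auto simp: indicator_def)
qed

text \<open>Pointwise the integrand tends to \<open>0\<close> because \<open>b - 1 < 0\<close>, and \<open>\<bar>\<rho>\<bar>\<close> dominates it. For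
  \<open>t < T + 1\<close> the kernel may be unbounded on \<open>{0<..T}\<close>; replacing \<open>t\<close> by \<open>max t (T + 1)\<close> does not
  affect the limit and makes the integrand integrable for every \<open>t\<close>.\<close>

lemma head_tendsto_0:
  fixes b T :: real and \<rho> :: "real \<Rightarrow> real"
  assumes "b < 1" and \<rho>: "set_integrable lebesgue {0<..T} \<rho>"
  shows "((\<lambda>t. LINT s:{0<..T}|lebesgue. (t - s) powr (b - 1) * \<rho> s) \<longlongrightarrow> 0) at_top"
proof -
  have "((\<lambda>t. LINT s|lebesgue. indicat_real {0<..T} s *\<^sub>R ((max t (T + 1) - s) powr (b - 1) * \<rho> s))
          \<longlongrightarrow> (LINT s::real|lebesgue. (0::real))) at_top"
  proof (rule integral_dominated_convergence_at_top)
    show "(\<lambda>s. indicat_real {0<..T} s *\<^sub>R ((max t (T + 1) - s) powr (b - 1) * \<rho> s))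
            \<in> borel_measurable lebesgue" for t
      using head_integrable[OF assms(1) _ \<rho>, of "max t (T + 1)"]
      by (simp add: set_integrable_def borel_measurable_integrable)
    show "integrable lebesgue (\<lambda>s. norm (indicat_real {0<..T} s *\<^sub>R \<rho> s))"
      using \<rho> unfolding set_integrable_def by (rule integrable_norm)
    show "\<forall>\<^sub>F t in at_top. AE s in lebesgue.
            norm (indicat_real {0<..T} s *\<^sub>R ((max t (T + 1) - s) powr (b - 1) * \<rho> s))
            \<le> norm (indicat_real {0<..T} s *\<^sub>R \<rho> s)"
      using head_integrand_le[OF assms(1), of T "max t (T + 1)" for t]
      by (intro always_eventually allI AE_I2) (simp add: indicator_def)
    have "((\<lambda>t. (max t (T + 1) - s) powr (b - 1)) \<longlongrightarrow> 0) at_top" for s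
    proof (rule Lim_transform_eventually)
      show "((\<lambda>t. (t - s) powr (b - 1)) \<longlongrightarrow> 0) at_top"
        using assms(1) by real_asymp
      show "\<forall>\<^sub>F t in at_top. (t - s) powr (b - 1) = (max t (T + 1) - s) powr (b - 1)"
        using eventually_ge_at_top[of "T + 1"] by eventually_elim (simp add: max_def)
    qed
    then have "((\<lambda>t. indicat_real {0<..T} s *\<^sub>R ((max t (T + 1) - s) powr (b - 1) * \<rho> s))
            \<longlongrightarrow> indicat_real {0<..T} s *\<^sub>R (0 * \<rho> s)) at_top" for s
      by (intro tendsto_intros)
    then show "AE s in lebesgue. ((\<lambda>t. indicat_real {0<..T} s *\<^sub>R ((max t (T + 1) - s) powr (b - 1) * \<rho> s))
            \<longlongrightarrow> 0) at_top"
      by simp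
  qed simp
  then have lim: "((\<lambda>t. LINT s:{0<..T}|lebesgue. (max t (T + 1) - s) powr (b - 1) * \<rho> s) \<longlongrightarrow> 0) at_top"
    by (simp add: set_lebesgue_integral_def)
  show ?thesis
  proof (rule Lim_transform_eventually[OF lim])
    show "\<forall>\<^sub>F t in at_top. (LINT s:{0<..T}|lebesgue. (max t (T + 1) - s) powr (b - 1) * \<rho> s)
            = (LINT s:{0<..T}|lebesgue. (t - s) powr (b - 1) * \<rho> s)"
      using eventually_ge_at_top[of "T + 1"] by eventually_elim (simp add: max_def)
  qed
qed

section \<open>The contribution away from the origin\<close>

text \<open>The Jacobian \<open>t\<close> and the factor \<open>t powr (b - 1)\<close> of the kernel combine to
  \<open>t powr b\<close>, which is absorbed into the weight \<open>(t * u) powr b * r\<close>.\<close>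

lemma Abel_kernel_scaling:
  fixes b t u r :: real
  assumes "0 < t" "0 < u" "u < 1"
  shows "t * ((t - t * u) powr (b - 1) * r)
          = u powr - b * (1 - u) powr (b - 1) * ((t * u) powr b * r)"
proof -
  have "(t - t * u) powr (b - 1) = t powr (b - 1) * (1 - u) powr (b - 1)"
    using assms by (simp add: powr_mult right_diff_distrib flip: powr_mult)
  moreover have "t * t powr (b - 1) = t powr b"
    using assms by (simp add: powr_mult_base)
  moreover have "(t * u) powr b = t powr b * u powr b" "u powr - b * u powr b = 1"
    using assms by (simp_all add: powr_mult flip: powr_add)
  ultimately show ?thesis
    by (simp add: mult_ac)
qed

text \<open>From here on \<open>T\<close> is a threshold beyond which \<open>s powr b * \<rho> s\<close> is bounded; such a threshold exists
  because this function has a limit at infinity.\<close>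

context
  fixes b a T K :: real and \<rho> :: "real \<Rightarrow> real"
  assumes b: "0 < b" "b < 1" and T: "0 < T"
    and cont: "continuous_on {0<..} \<rho>"
    and bound: "\<And>s. T < s \<Longrightarrow> \<bar>s powr b * \<rho> s\<bar> \<le> K"
    and lim: "((\<lambda>s. s powr b * \<rho> s) \<longlongrightarrow> a) at_top"
begin

definition tail_integrand :: "real \<Rightarrow> real \<Rightarrow> real" where
  "tail_integrand t s = indicator {T<..<t} s * ((t - s) powr (b - 1) * \<rho> s)"

text \<open>The integrand after the substitution \<open>s = t * u\<close>, with the Jacobian included. In this form the
  dependence on \<open>t\<close> is confined to a bounded weight and a cut-off (\<open>scaled_tail_eq\<close>).\<close>

definition scaled_tail :: "real \<Rightarrow> real \<Rightarrow> real" where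
  "scaled_tail t u = t * tail_integrand t (t * u)"

lemma tail_integrand_measurable [measurable]: "tail_integrand t \<in> borel_measurable borel"
proof -
  have "continuous_on {T<..<t} (\<lambda>s. (t - s) powr (b - 1) * \<rho> s)"
    using T by (intro continuous_intros continuous_on_subset[OF cont]) auto
  then have "(\<lambda>s. indicator {T<..<t} s *\<^sub>R ((t - s) powr (b - 1) * \<rho> s)) \<in> borel_measurable borel"
    by (intro borel_measurable_continuous_on_indicator) auto
  then show ?thesis
    by (simp add: tail_integrand_def[abs_def])
qed

lemma scaled_tail_measurable [measurable]: "scaled_tail t \<in> borel_measurable borel"
  unfolding scaled_tail_def[abs_def] by measurable

lemma scaled_tail_eq:
  assumes "0 < t"
  shows "scaled_tail t u = indicator {T / t<..<1} u *
           (u powr - b * (1 - u) powr (b - 1) * ((t * u) powr b * \<rho> (t * u)))"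
proof (cases "T / t < u \<and> u < 1")
  case True
  then have "0 < u"
    using T assms by (meson divide_pos_pos less_trans)
  with True assms T show ?thesis
    using Abel_kernel_scaling[of t u b "\<rho> (t * u)"]
    by (simp add: scaled_tail_def tail_integrand_def field_simps)
next
  case False
  with assms show ?thesis
    by (auto simp: scaled_tail_def tail_integrand_def indicator_def field_simps)
qed

text \<open>The cut-off \<open>T / t < u\<close> keeps \<open>t * u\<close> in the range where the weight is at most \<open>K\<close>, so one
  integrable function dominates all the \<open>scaled_tail t\<close>.\<close>

lemma scaled_tail_le:
  assumes "0 < t"
  shows "\<bar>scaled_tail t u\<bar> \<le> K * (indicator {0..1} u * (u powr - b * (1 - u) powr (b - 1)))"
proof (cases "T / t < u \<and> u < 1")
  case True
  then have u: "0 < u" "T < t * u"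
    using T assms by (auto simp: field_simps intro: less_trans[of 0 "T / t"])
  have "\<bar>scaled_tail t u\<bar> = u powr - b * (1 - u) powr (b - 1) * \<bar>(t * u) powr b * \<rho> (t * u)\<bar>"
    using True by (simp add: scaled_tail_eq[OF assms] abs_mult)
  also have "\<dots> \<le> u powr - b * (1 - u) powr (b - 1) * K"
    using bound[OF u(2)] by (intro mult_left_mono) auto
  finally show ?thesis
    using True u by (simp add: mult_ac)
next
  case False
  have "0 \<le> K"
    using bound[of "T + 1"] by linarith
  with False show ?thesis
    by (auto simp: scaled_tail_eq[OF assms] indicator_def)
qed

lemma scaled_tail_integrable:
  assumes "0 < t"
  shows "integrable lborel (scaled_tail t)"
proof (rule Bochner_Integration.integrable_bound)
  show "integrable lborel (\<lambda>u. K * (indicator {0..1} u * (u powr - b * (1 - u) powr (b - 1))))"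
    using Beta_kernel_lborel(1)[OF b] by (rule integrable_mult_right)
  show "AE u in lborel. norm (scaled_tail t u)
          \<le> norm (K * (indicator {0..1} u * (u powr - b * (1 - u) powr (b - 1))))"
    using scaled_tail_le[OF assms] by (intro AE_I2) (metis abs_ge_self order_trans real_norm_def)
qed simp

lemma tail_integrable:
  assumes "0 < t"
  shows "set_integrable lebesgue {T<..<t} (\<lambda>s. (t - s) powr (b - 1) * \<rho> s)"
proof -
  have "integrable lborel (\<lambda>u. tail_integrand t (0 + t * u))"
    using scaled_tail_integrable[OF assms] assms by (simp add: scaled_tail_def[abs_def])
  then have "integrable lborel (tail_integrand t)"
    using assms by (subst (asm) lborel_integrable_real_affine_iff) auto
  then have "integrable lebesgue (tail_integrand t)"
    by (simp add: integrable_completion)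
  then show ?thesis
    by (simp add: set_integrable_def tail_integrand_def[abs_def])
qed

lemma tail_integral_eq_scaled:
  assumes "0 < t"
  shows "(LINT s:{T<..<t}|lebesgue. (t - s) powr (b - 1) * \<rho> s) = integral\<^sup>L lborel (scaled_tail t)"
proof -
  have "(LINT s:{T<..<t}|lebesgue. (t - s) powr (b - 1) * \<rho> s) = integral\<^sup>L lebesgue (tail_integrand t)"
    by (simp add: set_lebesgue_integral_def tail_integrand_def[abs_def])
  also have "\<dots> = integral\<^sup>L lborel (tail_integrand t)"
    by (intro integral_completion) simp
  also have "\<dots> = integral\<^sup>L lborel (scaled_tail t)"
    using lborel_integral_real_affine[of t "tail_integrand t" 0] assms
    by (simp add: scaled_tail_def[abs_def])
  finally show ?thesis .
qed

text \<open>For fixed \<open>u > 0\<close> the argument \<open>t * u\<close> tends to infinity, so the weight tends to \<open>a\<close>, and \<open>u\<close>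
  eventually exceeds the cut-off \<open>T / t\<close>.\<close>

lemma scaled_tail_pointwise:
  assumes "0 < u" "u < 1"
  shows "((\<lambda>t. scaled_tail t u) \<longlongrightarrow> a * (u powr - b * (1 - u) powr (b - 1))) at_top"
proof (rule Lim_transform_eventually)
  have "filterlim (\<lambda>t. t * u) at_top at_top"
    using assms(1) by real_asymp
  then have "((\<lambda>t. (t * u) powr b * \<rho> (t * u)) \<longlongrightarrow> a) at_top"
    by (rule filterlim_compose[OF lim])
  then show "((\<lambda>t. ((t * u) powr b * \<rho> (t * u)) * (u powr - b * (1 - u) powr (b - 1)))
               \<longlongrightarrow> a * (u powr - b * (1 - u) powr (b - 1))) at_top"
    by (rule tendsto_mult_right)
  show "\<forall>\<^sub>F t in at_top. ((t * u) powr b * \<rho> (t * u)) * (u powr - b * (1 - u) powr (b - 1))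
          = scaled_tail t u"
    using eventually_gt_at_top[of 0] eventually_gt_at_top[of "T / u"]
  proof eventually_elim
    case (elim t)
    then have "T / t < u"
      using assms by (simp add: field_simps)
    with elim assms show ?case
      by (simp add: scaled_tail_eq)
  qed
qed

lemma tail_tendsto:
  "((\<lambda>t. LINT s:{T<..<t}|lebesgue. (t - s) powr (b - 1) * \<rho> s) \<longlongrightarrow> a * pi / sin (b * pi)) at_top"
proof -
  define k where "k = (\<lambda>u::real. indicator {0..1} u * (u powr - b * (1 - u) powr (b - 1)))"
  have k: "integrable lborel k" "integral\<^sup>L lborel k = pi / sin (b * pi)"
    unfolding k_def by (rule Beta_kernel_lborel[OF b])+
  have "((\<lambda>t. integral\<^sup>L lborel (scaled_tail t)) \<longlongrightarrow> (LINT u|lborel. a * k u)) at_top"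
  proof (rule integral_dominated_convergence_at_top)
    show "integrable lborel (\<lambda>u. K * k u)"
      using k(1) by (rule integrable_mult_right)
    show "(\<lambda>u. a * k u) \<in> borel_measurable lborel"
      unfolding k_def by measurable
    show "\<forall>\<^sub>F t in at_top. AE u in lborel. norm (scaled_tail t u) \<le> K * k u"
      using eventually_gt_at_top[of 0] by eventually_elim (simp add: k_def scaled_tail_le)
    have "((\<lambda>t. scaled_tail t u) \<longlongrightarrow> a * k u) at_top" if "u \<noteq> 0" "u \<noteq> 1" for u
    proof (cases "0 < u \<and> u < 1")
      case True
      then show ?thesis
        using scaled_tail_pointwise[of u] by (simp add: k_def)
    next
      case False
      with that have out: "u < 0 \<or> 1 < u"
        by linarith
      have "\<forall>\<^sub>F t in at_top. a * k u = scaled_tail t u"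
        using eventually_gt_at_top[of 0]
      proof eventually_elim
        case (elim t)
        then have "0 < T / t"
          using T by simp
        with out elim show ?case
          by (auto simp: k_def scaled_tail_eq indicator_def)
      qed
      then show ?thesis
        by (rule Lim_transform_eventually[OF tendsto_const])
    qed
    moreover have "AE u in lborel. u \<noteq> (0::real)" "AE u in lborel. u \<noteq> (1::real)"
      by (rule AE_lborel_singleton)+
    ultimately show "AE u in lborel. ((\<lambda>t. scaled_tail t u) \<longlongrightarrow> a * k u) at_top"
      by auto
  qed simp
  then have "((\<lambda>t. integral\<^sup>L lborel (scaled_tail t)) \<longlongrightarrow> a * pi / sin (b * pi)) at_top"
    by (simp add: k(2))
  then show ?thesis
  proof (rule Lim_transform_eventually)
    show "\<forall>\<^sub>F t in at_top. integral\<^sup>L lborel (scaled_tail t)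
            = (LINT s:{T<..<t}|lebesgue. (t - s) powr (b - 1) * \<rho> s)"
      using eventually_gt_at_top[of 0] by eventually_elim (simp add: tail_integral_eq_scaled)
  qed
qed

end

section \<open>The limit of the Abel integral\<close>

theorem lemma2p8:
  fixes \<beta> a :: real and \<rho> :: "real \<Rightarrow> real"
  assumes "0 < \<beta>" and "\<beta> < 1"
    and "continuous_on {0<..} \<rho>" and "\<rho> \<in> L1_Loc"
    and "((\<lambda>t. t powr \<beta> * \<rho> t) \<longlongrightarrow> a) at_top"
  shows "((\<lambda>t. LINT s:{0<..<t}|lebesgue. (t - s) powr (\<beta> - 1) * \<rho> s)
           \<longlongrightarrow> a * pi / sin (\<beta> * pi)) at_top"
proof -
  let ?f = "\<lambda>t s. (t - s) powr (\<beta> - 1) * \<rho> s"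
  have "\<forall>\<^sub>F s in at_top. \<bar>s powr \<beta> * \<rho> s\<bar> < \<bar>a\<bar> + 1"
    using order_tendstoD(2)[OF tendsto_rabs[OF assms(5)], of "\<bar>a\<bar> + 1"] by simp
  then obtain N where N: "\<And>s. N \<le> s \<Longrightarrow> \<bar>s powr \<beta> * \<rho> s\<bar> < \<bar>a\<bar> + 1"
    by (auto simp: eventually_at_top_linorder)
  define T where "T = max N 1"
  have T: "0 < T"
    by (simp add: T_def)
  have bound: "\<bar>s powr \<beta> * \<rho> s\<bar> \<le> \<bar>a\<bar> + 1" if "T < s" for s
    using N[of s] that by (simp add: T_def)
  have head: "set_integrable lebesgue {0<..T} \<rho>"
    using assms(4)[unfolded L1_Loc_def mem_Collect_eq, rule_format, of "{0<..T}"]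
    by (simp add: is_interval_oc subset_iff)
  note tail = assms(1,2) T assms(3) bound assms(5)
  note tail_lim = tail_tendsto[of \<beta> T \<rho> "\<bar>a\<bar> + 1" a, OF tail]
  note tail_int = tail_integrable[of \<beta> T \<rho> "\<bar>a\<bar> + 1" a, OF tail]
  have "((\<lambda>t. (LINT s:{0<..T}|lebesgue. ?f t s) + (LINT s:{T<..<t}|lebesgue. ?f t s))
          \<longlongrightarrow> 0 + a * pi / sin (\<beta> * pi)) at_top"
    by (rule tendsto_add[OF head_tendsto_0[OF assms(2) head] tail_lim])
  then have "((\<lambda>t. (LINT s:{0<..T}|lebesgue. ?f t s) + (LINT s:{T<..<t}|lebesgue. ?f t s))
          \<longlongrightarrow> a * pi / sin (\<beta> * pi)) at_top"
    by simp
  then show ?thesis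
  proof (rule Lim_transform_eventually)
    show "\<forall>\<^sub>F t in at_top. (LINT s:{0<..T}|lebesgue. ?f t s) + (LINT s:{T<..<t}|lebesgue. ?f t s)
            = (LINT s:{0<..<t}|lebesgue. ?f t s)"
      using eventually_ge_at_top[of "T + 1"]
    proof eventually_elim
      case (elim t)
      have "{0<..<t} = {0<..T} \<union> {T<..<t}"
        using T elim by auto
      moreover have "(LINT s:{0<..T} \<union> {T<..<t}|lebesgue. ?f t s)
          = (LINT s:{0<..T}|lebesgue. ?f t s) + (LINT s:{T<..<t}|lebesgue. ?f t s)"
        using T elim
        by (intro set_integral_Un head_integrable[OF assms(2) elim head] tail_int) auto
      ultimately show ?case
        by simp
    qed
  qed
qed

end
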